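(* As formal power series in $x$ with coefficients in $\mathbb{Q}[s,t,u,v]$, $$D^{(\mathsf{cpk},\mathsf{cval},\mathsf{cdasc},\mathsf{cddes})}(s,t,u,v;x)=\frac{1}{1-st\,V\big(st,(u+v)/2;x\big)}.$$
   Context: Let $\mathfrak{D}_n$ be the set of derangements of $[n]=\{1,\dots,n\}$, i.e. permutations $\pi=\pi_1\cdots\pi_n$ (one-line notation, $\pi_i=\pi(i)$) with $\pi_i\ne i$ for all $i$. For a permutation $\pi$ of $[n]$, the letter $\pi_i$ is a cyclic peak if $i<\pi_i>\pi_{\pi_i}$, a cyclic valley if $i>\pi_i<\pi_{\pi_i}$, a cyclic double ascent if $i<\pi_i<\pi_{\pi_i}$, and a cyclic double descent if $i>\pi_i>\pi_{\pi_i}$. Let $\mathsf{cpk}(\pi),\mathsf{cval}(\pi),\mathsf{cdasc}(\pi),\mathsf{cddes}(\pi)$ be the numbers of cyclic peaks, cyclic valleys, cyclic double ascents and cyclic double descents of $\pi$, respectively. Define $$D^{(\mathsf{cpk},\mathsf{cval},\mathsf{cdasc},\mathsf{cddes})}(s,t,u,v;x)=1+\sum_{n=1}^\infty\Big(\sum_{\pi\in\mathfrak{D}_n}s^{\mathsf{cpk}(\pi)}t^{\mathsf{cval}(\pi)}u^{\mathsf{cdasc}(\pi)}v^{\mathsf{cddes}(\pi)}\Big)\frac{x^n}{n!}.$$ The bivariate Chebyshev polynomials of the second kind are defined by $U_0(s,t)=1$, $U_1(s,t)=2t$, and $U_n(s,t)=2tU_{n-1}(s,t)-sU_{n-2}(s,t)$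 for $n\ge2$. Define $V(s,t;x)=\sum_{n=0}^\infty U_n(s,t)\frac{x^{n+2}}{(n+2)!}$; $V(st,(u+v)/2;x)$ denotes the series obtained by substituting $st$ for the first argument $s$ and $(u+v)/2$ for the second argument $t$. *)

theory Defs
  imports
    "HOL-Combinatorics.Permutations"
    "HOL-Library.Poly_Mapping"
    "HOL-Computational_Algebra.Formal_Power_Series"
begin

section \<open>The polynomial ring in four variables over the rationals\<close>

datatype var4 = Var_s | Var_t | Var_u | Var_v

text \<open>
  Monomials are exponent vectors \<^typ>\<open>var4 \<Rightarrow>\<^sub>0 nat\<close>; a polynomial maps finitely many
  monomials to nonzero coefficients. Multiplication on \<^type>\<open>poly_mapping\<close> is
  convolution, i.e. polynomial multiplication.
\<close>

type_synonym qpoly4 = "(var4 \<Rightarrow>\<^sub>0 nat) \<Rightarrow>\<^sub>0 rat"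

definition qvar :: "var4 \<Rightarrow> qpoly4" where
  "qvar w = Poly_Mapping.single (Poly_Mapping.single w 1) 1"

definition qconst :: "rat \<Rightarrow> qpoly4" where
  "qconst c = Poly_Mapping.single 0 c"


section \<open>Derangements and cyclic statistics\<close>

definition derangements :: "nat \<Rightarrow> (nat \<Rightarrow> nat) set" where
  "derangements n = {\<pi>. \<pi> permutes {1..n} \<and> (\<forall>i\<in>{1..n}. \<pi> i \<noteq> i)}"

text \<open>
  The statistics classify the letters \<open>\<pi> i\<close>. As \<open>\<pi>\<close> is injective, letters are counted
  by their positions \<open>i\<close>.
\<close>

definition cpk :: "nat \<Rightarrow> (nat \<Rightarrow> nat) \<Rightarrow> nat" where
  "cpk n \<pi> = card {i\<in>{1..n}. i < \<pi> i \<and> \<pi> i > \<pi> (\<pi> i)}"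

definition cval :: "nat \<Rightarrow> (nat \<Rightarrow> nat) \<Rightarrow> nat" where
  "cval n \<pi> = card {i\<in>{1..n}. i > \<pi> i \<and> \<pi> i < \<pi> (\<pi> i)}"

definition cdasc :: "nat \<Rightarrow> (nat \<Rightarrow> nat) \<Rightarrow> nat" where
  "cdasc n \<pi> = card {i\<in>{1..n}. i < \<pi> i \<and> \<pi> i < \<pi> (\<pi> i)}"

definition cddes :: "nat \<Rightarrow> (nat \<Rightarrow> nat) \<Rightarrow> nat" where
  "cddes n \<pi> = card {i\<in>{1..n}. i > \<pi> i \<and> \<pi> i > \<pi> (\<pi> i)}"

definition derangement_gf :: "qpoly4 \<Rightarrow> qpoly4 \<Rightarrow> qpoly4 \<Rightarrow> qpoly4 \<Rightarrow> qpoly4 fps" where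
  "derangement_gf s t u v = 1 + Abs_fps (\<lambda>n. if n = 0 then 0 else
     (\<Sum>\<pi>\<in>derangements n. s ^ cpk n \<pi> * t ^ cval n \<pi> * u ^ cdasc n \<pi> * v ^ cddes n \<pi>)
       * qconst (1 / fact n))"


section \<open>Bivariate Chebyshev polynomials of the second kind\<close>

fun cheb_U :: "nat \<Rightarrow> 'a::comm_ring_1 \<Rightarrow> 'a \<Rightarrow> 'a" where
  "cheb_U 0 s t = 1"
| "cheb_U (Suc 0) s t = 2 * t"
| "cheb_U (Suc (Suc n)) s t = 2 * t * cheb_U (Suc n) s t - s * cheb_U n s t"

text \<open>The coefficient of \<open>x ^ (n + 2)\<close> is \<open>U\<^sub>n(s,t) / (n + 2)!\<close>.\<close>

definition cheb_V :: "qpoly4 \<Rightarrow> qpoly4 \<Rightarrow> qpoly4 fps" where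
  "cheb_V s t = Abs_fps (\<lambda>m. if m < 2 then 0 else cheb_U (m - 2) s t * qconst (1 / fact m))"


section \<open>Reciprocals of power series with constant term 1\<close>

text \<open>
  The library's \<^const>\<open>inverse\<close> on power series needs an inverse operation on the
  coefficients and is there \<open>fps_right_inverse f (inverse (fps_nth f 0))\<close>. The coefficient ring
  used here has no such operation, but for \<open>fps_nth f 0 = 1\<close> the inverse of the constant term
  is 1. The lemma below shows that this is then the unique multiplicative inverse.
\<close>

definition fps_recip :: "'a::comm_ring_1 fps \<Rightarrow> 'a fps" where
  "fps_recip f = fps_right_inverse f 1"

lemma fps_recip_unique:
  fixes f g :: "'a::comm_ring_1 fps"
  assumes "fps_nth f 0 = 1"
  shows "g = fps_recip f \<longleftrightarrow> g * f = 1"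
proof -
  have inv: "f * fps_recip f = 1"
    unfolding fps_recip_def using assms by (intro fps_right_inverse) simp
  show ?thesis
  proof
    assume "g = fps_recip f"
    then show "g * f = 1" using inv by (simp add: mult.commute)
  next
    assume "g * f = 1"
    then have "g * (f * fps_recip f) = fps_recip f"
      by (simp flip: mult.assoc)
    then show "g = fps_recip f" by (simp add: inv)
  qed
qed

lemma cheb_V_denominator_nth_0:
  "fps_nth (1 - fps_const (s * t) * cheb_V a b) 0 = 1"
  by (simp add: cheb_V_def)

end

theory Submission
  imports Defs
begin

text \<open>Let \<open>D\<close> be the derivation of the polynomial ring with \<open>D s = s (u + v)\<close>, \<open>D t = 0\<close> and
  \<open>D u = D v = s t\<close>. Inserting a new maximum into all arcs of a derangement acts on its weight as
  \<open>D\<close>, and inserting it as part of a 2-cycle contributes a factor \<open>s t\<close>; hence the generating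
  function \<open>G\<close> satisfies \<open>G' = D G + s t x G\<close>. On the other side
  \<open>D U\<^sub>n\<^sub>+\<^sub>1 = (n + 2) s t U\<^sub>n\<close>, which says that \<open>F = 1 - s t V\<close> satisfies \<open>F' = D F - s t x F\<close>.
  Therefore \<open>(G F)' = D (G F)\<close>, and as \<open>G F\<close> has constant term 1, which \<open>D\<close> kills, \<open>G F = 1\<close>.\<close>

section \<open>Derivations\<close>

locale derivation =
  fixes D :: "'a::comm_ring_1 \<Rightarrow> 'a"
  assumes add: "D (x + y) = D x + D y"
    and mult: "D (x * y) = x * D y + D x * y"
begin

lemma zero [simp]: "D 0 = 0"
  using add[of 0 0] by simp

lemma one [simp]: "D 1 = 0"
  using mult[of 1 1] by simp

lemma minus: "D (- x) = - D x"
  using add[of x "- x"] by (simp add: eq_neg_iff_add_eq_0 add.commute)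

lemma diff: "D (x - y) = D x - D y"
  using add[of x "- y"] by (simp add: minus)

lemma of_nat [simp]: "D (of_nat n) = 0"
  by (induction n) (simp_all add: add)

lemma numeral [simp]: "D (numeral k) = 0"
  using of_nat[of "numeral k"] by simp

lemma sum: "D (\<Sum>i\<in>A. f i) = (\<Sum>i\<in>A. D (f i))"
  by (induction A rule: infinite_finite_induct) (simp_all add: add)

lemma prod:
  assumes "finite A"
  shows "D (\<Prod>i\<in>A. f i) = (\<Sum>i\<in>A. D (f i) * (\<Prod>j\<in>A - {i}. f j))"
  using assms
proof induction
  case empty
  show ?case by simp
next
  case (insert a A)
  have "(\<Prod>j\<in>insert a A - {i}. f j) = f a * (\<Prod>j\<in>A - {i}. f j)" if "i \<in> A" for i
  proof -
    have "insert a A - {i} = insert a (A - {i})" using insert.hyps that by auto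
    then show ?thesis using insert.hyps by simp
  qed
  then have "(\<Sum>i\<in>A. D (f i) * (\<Prod>j\<in>insert a A - {i}. f j))
      = f a * (\<Sum>i\<in>A. D (f i) * (\<Prod>j\<in>A - {i}. f j))"
    by (simp add: sum_distrib_left mult.left_commute)
  moreover have "insert a A - {a} = A" using insert.hyps by auto
  ultimately show ?case
    using insert by (simp add: mult add.commute)
qed

end

section \<open>Coefficientwise extension of a derivation to power series\<close>

definition fps_map :: "('a \<Rightarrow> 'b) \<Rightarrow> 'a fps \<Rightarrow> 'b fps" where
  "fps_map h F = Abs_fps (\<lambda>n. h (fps_nth F n))"

lemma fps_map_nth [simp]: "fps_nth (fps_map h F) n = h (fps_nth F n)"
  by (simp add: fps_map_def)

lemma (in derivation) derivation_fps_map: "derivation (fps_map D)"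
proof
  fix F G :: "'a fps"
  show "fps_map D (F + G) = fps_map D F + fps_map D G"
    by (simp add: fps_eq_iff add)
  show "fps_map D (F * G) = F * fps_map D G + fps_map D F * G"
    by (simp add: fps_eq_iff fps_mult_nth sum mult sum.distrib)
qed

lemma derivation_scale:
  assumes "derivation D"
  shows "derivation (\<lambda>x. c * D x)"
proof -
  interpret derivation D by fact
  show ?thesis by unfold_locales (simp_all add: add mult algebra_simps)
qed

lemma derivation_plus:
  assumes "derivation D" "derivation E"
  shows "derivation (\<lambda>x. D x + E x)"
proof -
  interpret D: derivation D by fact
  interpret E: derivation E by fact
  show ?thesis by unfold_locales (simp_all add: D.add D.mult E.add E.mult algebra_simps)
qed

section \<open>Partial derivatives of polynomials\<close>

text \<open>The formal partial derivative in \<open>w\<close>. Subtraction of exponents is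
  truncated; where it truncates, the factor \<open>Poly_Mapping.lookup m w\<close> is zero.\<close>

definition pm_deriv ::
  "'v \<Rightarrow> (('v \<Rightarrow>\<^sub>0 nat) \<Rightarrow>\<^sub>0 'b::comm_ring_1) \<Rightarrow> (('v \<Rightarrow>\<^sub>0 nat) \<Rightarrow>\<^sub>0 'b)" where
  "pm_deriv w f = (\<Sum>m\<in>Poly_Mapping.keys f. Poly_Mapping.single (m - Poly_Mapping.single w 1)
     (Poly_Mapping.lookup f m * of_nat (Poly_Mapping.lookup m w)))"

text \<open>Monomials outside the support contribute zero. Additivity needs such a common index set,
  since cancellation may shrink the support of a sum.\<close>

lemma pm_deriv_superset:
  assumes "finite A" "Poly_Mapping.keys f \<subseteq> A"
  shows "pm_deriv w f = (\<Sum>m\<in>A. Poly_Mapping.single (m - Poly_Mapping.single w 1)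
     (Poly_Mapping.lookup f m * of_nat (Poly_Mapping.lookup m w)))"
  unfolding pm_deriv_def
  by (rule sum.mono_neutral_left) (use assms in \<open>auto simp: in_keys_iff\<close>)

lemma pm_deriv_add: "pm_deriv w (f + g) = pm_deriv w f + pm_deriv w g"
proof -
  let ?A = "Poly_Mapping.keys f \<union> Poly_Mapping.keys g"
  have A: "finite ?A" "Poly_Mapping.keys f \<subseteq> ?A" "Poly_Mapping.keys g \<subseteq> ?A"
    "Poly_Mapping.keys (f + g) \<subseteq> ?A"
    using keys_add[of f g] by auto
  show ?thesis
    unfolding pm_deriv_superset[OF A(1,2)] pm_deriv_superset[OF A(1,3)] pm_deriv_superset[OF A(1,4)]
    by (simp add: lookup_add distrib_right single_add sum.distrib)
qed

lemma pm_deriv_single: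
  "pm_deriv w (Poly_Mapping.single m c) =
     Poly_Mapping.single (m - Poly_Mapping.single w 1) (c * of_nat (Poly_Mapping.lookup m w))"
  by (cases "c = 0") (simp_all add: pm_deriv_def)

lemma poly_mapping_add_single_induct [case_names zero add_single]:
  fixes f :: "'a \<Rightarrow>\<^sub>0 'b::comm_monoid_add"
  assumes "P 0" and "\<And>f m c. P f \<Longrightarrow> P (f + Poly_Mapping.single m c)"
  shows "P f"
proof (induction f rule: update_induct)
  case const
  show ?case by fact
next
  case (update f m c)
  have "Poly_Mapping.update m c f = f + Poly_Mapping.single m c"
    using update by (intro poly_mapping_eqI)
      (auto simp: lookup_update lookup_add lookup_single in_keys_iff when_def)
  then show ?case using assms(2) update by simp
qed

lemma pm_deriv_mult_single:
  "pm_deriv w (Poly_Mapping.single a x * Poly_Mapping.single b y) =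
     Poly_Mapping.single a x * pm_deriv w (Poly_Mapping.single b y) +
     pm_deriv w (Poly_Mapping.single a x) * Poly_Mapping.single b y"
proof -
  let ?e = "Poly_Mapping.single w (1::nat)"
  \<comment> \<open>If \<open>w\<close> does not occur in \<open>k\<close>, both coefficients
    vanish; otherwise the subtraction is exact and commutes with adding \<open>m\<close>.\<close>
  have shift: "Poly_Mapping.single (m + (k - ?e)) (c * of_nat (Poly_Mapping.lookup k w)) =
      Poly_Mapping.single (m + k - ?e) (c * of_nat (Poly_Mapping.lookup k w))"
    for m k and c :: 'b
  proof (cases "Poly_Mapping.lookup k w = 0")
    case False
    then have "m + (k - ?e) = m + k - ?e"
      by (intro poly_mapping_eqI) (auto simp: lookup_add lookup_minus lookup_single when_def)
    then show ?thesis by simp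
  qed simp
  show ?thesis
    using shift[of a b "x * y"] shift[of b a "x * y"]
    by (simp add: pm_deriv_single mult_single lookup_add distrib_left single_add
        add.commute mult.assoc mult.commute mult.left_commute)
qed

lemma derivation_pm_deriv: "derivation (pm_deriv w)"
proof
  fix f g :: "('a \<Rightarrow>\<^sub>0 nat) \<Rightarrow>\<^sub>0 'b"
  have [simp]: "pm_deriv w 0 = (0 :: ('a \<Rightarrow>\<^sub>0 nat) \<Rightarrow>\<^sub>0 'b)"
    by (simp add: pm_deriv_def)
  show "pm_deriv w (f + g) = pm_deriv w f + pm_deriv w g"
    by (rule pm_deriv_add)
  \<comment> \<open>The product rule extends from monomials by additivity, first in the left factor
    and then in the right one.\<close>
  have single: "pm_deriv w (f * Poly_Mapping.single b y) =
      f * pm_deriv w (Poly_Mapping.single b y) + pm_deriv w f * Poly_Mapping.single b y"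
    for b y
    by (induction f rule: poly_mapping_add_single_induct)
      (simp_all add: pm_deriv_add pm_deriv_mult_single algebra_simps)
  show "pm_deriv w (f * g) = f * pm_deriv w g + pm_deriv w f * g"
    by (induction g rule: poly_mapping_add_single_induct)
      (simp_all add: pm_deriv_add single algebra_simps)
qed

lemma pm_deriv_qvar: "pm_deriv w (qvar z) = (if z = w then 1 else 0)"
  by (auto simp: qvar_def pm_deriv_single lookup_single)

lemma pm_deriv_qconst: "pm_deriv w (qconst c) = 0"
  by (simp add: qconst_def pm_deriv_single)

section \<open>Derangements of a finite set\<close>

text \<open>General sets occur because deleting a 2-cycle from a derangement of an interval may
  leave a set with a gap.\<close>

definition derangements_on :: "'a set \<Rightarrow> ('a \<Rightarrow> 'a) set" where
  "derangements_on A = {\<pi>. \<pi> permutes A \<and> (\<forall>i\<in>A. \<pi> i \<noteq> i)}"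

lemma finite_derangements_on: "finite A \<Longrightarrow> finite (derangements_on A)"
  by (rule finite_subset[OF _ finite_permutations[of A]]) (auto simp: derangements_on_def)

text \<open>In cycle notation, \<open>\<sigma> \<circ> transpose i m\<close> arises from \<open>\<sigma>\<close> by inserting the fixed point \<open>m\<close>
  into the arc \<open>i \<rightarrow> \<sigma> i\<close>. Removing \<open>m\<close> from a derangement leaves a derangement, unless \<open>m\<close> lies
  on a 2-cycle, whose other element then becomes a fixed point.\<close>

lemma derangements_on_insert:
  assumes "m \<notin> A"
  shows "derangements_on (insert m A) =
    (\<Union>i\<in>A. (\<lambda>\<sigma>. \<sigma> \<circ> transpose i m) ` (derangements_on A \<union> derangements_on (A - {i})))"
    (is "?L = ?R")
proof (intro equalityI subsetI)
  fix \<pi> assume "\<pi> \<in> ?L"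
  then have \<pi>: "\<pi> permutes insert m A" "\<And>i. i \<in> insert m A \<Longrightarrow> \<pi> i \<noteq> i"
    by (auto simp: derangements_on_def)
  obtain i where i: "\<pi> i = m" using \<pi>(1) by (metis permutes_def)
  then have "i \<noteq> m" using \<pi>(2)[of m] by auto
  have "i \<in> A" using i \<open>i \<noteq> m\<close> \<pi>(1) by (metis insertE permutes_not_in)
  define \<sigma> where "\<sigma> = \<pi> \<circ> transpose i m"
  have eq: "\<pi> = \<sigma> \<circ> transpose i m" by (simp add: \<sigma>_def comp_assoc)
  have "\<sigma> permutes insert m A"
    unfolding \<sigma>_def using \<open>i \<in> A\<close> \<pi>(1) by (intro permutes_compose permutes_swap_id) auto
  moreover have \<sigma>m: "\<sigma> m = m" by (simp add: \<sigma>_def i)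
  ultimately have \<sigma>: "\<sigma> permutes A"
    by (intro permutes_superset[of \<sigma> "insert m A" A]) auto
  have fixfree: "\<sigma> j \<noteq> j" if "j \<in> A - {i}" for j
    using that assms \<pi>(2)[of j] by (auto simp: \<sigma>_def transpose_def)
  have "\<sigma> \<in> derangements_on A \<union> derangements_on (A - {i})"
  proof (cases "\<sigma> i = i")
    case True
    then have "\<sigma> permutes (A - {i})"
      using \<sigma> by (intro permutes_superset[OF \<sigma>]) auto
    then show ?thesis using fixfree by (simp add: derangements_on_def)
  next
    case False
    then show ?thesis using \<sigma> fixfree by (auto simp: derangements_on_def)
  qed
  then show "\<pi> \<in> ?R" using eq \<open>i \<in> A\<close> by blast
next
  fix \<pi> assume "\<pi> \<in> ?R"
  then obtain i \<sigma> where i: "i \<in> A" and eq: "\<pi> = \<sigma> \<circ> transpose i m"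
    and cases: "\<sigma> \<in> derangements_on A \<or> \<sigma> \<in> derangements_on (A - {i})"
    by blast
  have \<sigma>: "\<sigma> permutes A" and fixfree: "\<And>j. j \<in> A - {i} \<Longrightarrow> \<sigma> j \<noteq> j"
    using cases by (auto simp: derangements_on_def intro: permutes_subset[of _ "A - {i}"])
  have "\<sigma> m = m" using \<sigma> assms by (rule permutes_not_in)
  have "\<sigma> i \<in> A" using \<sigma> i by (simp add: permutes_in_image)
  have "\<pi> permutes insert m A"
    unfolding eq using i \<sigma>
    by (intro permutes_compose permutes_swap_id) (auto intro: permutes_imp_permutes_insert)
  moreover have "\<pi> j \<noteq> j" if "j \<in> insert m A" for j
    using that fixfree[of j] i assms \<open>\<sigma> m = m\<close> \<open>\<sigma> i \<in> A\<close> by (auto simp: eq transpose_def)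
  ultimately show "\<pi> \<in> ?L" by (simp add: derangements_on_def)
qed

text \<open>The union is disjoint: \<open>i\<close> is recovered as the preimage of
  \<open>m\<close>, composing with the transposition is an involution, and the two families for one
  \<open>i\<close> differ in whether \<open>\<sigma>\<close> moves \<open>i\<close>.\<close>

lemma sum_derangements_on_insert:
  fixes f :: "('a \<Rightarrow> 'a) \<Rightarrow> 'b::comm_monoid_add"
  assumes "finite A" "m \<notin> A"
  shows "(\<Sum>\<pi>\<in>derangements_on (insert m A). f \<pi>) =
    (\<Sum>i\<in>A. (\<Sum>\<sigma>\<in>derangements_on A. f (\<sigma> \<circ> transpose i m)) +
       (\<Sum>\<sigma>\<in>derangements_on (A - {i}). f (\<sigma> \<circ> transpose i m)))"
proof -
  let ?D = "\<lambda>i. derangements_on A \<union> derangements_on (A - {i})"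
  let ?h = "\<lambda>i \<sigma>. \<sigma> \<circ> transpose i m"
  have inj: "inj_on (?h i) X" for i X
    by (rule inj_on_inverseI[of _ "?h i"]) (simp add: comp_assoc)
  have m: "(?h i \<sigma>) i = m" "bij (?h i \<sigma>)" if "i \<in> A" "\<sigma> \<in> ?D i" for i \<sigma>
  proof -
    have "\<sigma> permutes A"
      using that by (auto simp: derangements_on_def intro: permutes_subset[of _ "A - {i}"])
    then show "(?h i \<sigma>) i = m" "bij (?h i \<sigma>)"
      using assms(2) by (auto simp: permutes_not_in permutes_bij intro: bij_comp)
  qed
  have disj: "?h i ` ?D i \<inter> ?h j ` ?D j = {}" if "i \<in> A" "j \<in> A" "i \<noteq> j" for i j
  proof -
    have False if "\<sigma> \<in> ?D i" "\<tau> \<in> ?D j" "?h i \<sigma> = ?h j \<tau>" for \<sigma> \<tau>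
      using m[OF \<open>i \<in> A\<close> that(1)] m[OF \<open>j \<in> A\<close> that(2)] that(3) \<open>i \<noteq> j\<close>
      by (metis bij_is_inj injD)
    then show ?thesis by blast
  qed
  have fin: "finite (derangements_on A)" "finite (derangements_on (A - {i}))" for i
    using assms by (auto intro: finite_derangements_on)
  have disj': "derangements_on A \<inter> derangements_on (A - {i}) = {}" if "i \<in> A" for i
    using that by (auto simp: derangements_on_def permutes_def)
  have "(\<Sum>\<pi>\<in>derangements_on (insert m A). f \<pi>) = (\<Sum>i\<in>A. \<Sum>\<pi>\<in>?h i ` ?D i. f \<pi>)"
    unfolding derangements_on_insert[OF assms(2)]
    by (rule sum.UNION_disjoint) (use assms fin disj in auto)
  also have "\<dots> = (\<Sum>i\<in>A. \<Sum>\<sigma>\<in>?D i. f (?h i \<sigma>))"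
    by (subst sum.reindex[OF inj]) (simp add: o_def)
  also have "\<dots> = (\<Sum>i\<in>A. (\<Sum>\<sigma>\<in>derangements_on A. f (?h i \<sigma>)) +
       (\<Sum>\<sigma>\<in>derangements_on (A - {i}). f (?h i \<sigma>)))"
    by (intro sum.cong refl sum.union_disjoint fin disj')
  finally show ?thesis .
qed

section \<open>The weight of a derangement\<close>

locale cyclic_grammar = derivation D for D :: "'a::comm_ring_1 \<Rightarrow> 'a" +
  fixes s t u v :: 'a
  assumes D_s: "D s = s * (u + v)"
    and D_t: "D t = 0"
    and D_u: "D u = s * t"
    and D_v: "D v = s * t"
begin

text \<open>The arguments say whether the arc into the letter and the arc out of it ascend.\<close>

definition letter :: "bool \<Rightarrow> bool \<Rightarrow> 'a" where
  "letter a b = (if a then if b then u else s else if b then t else v)"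

text \<open>Indexing by the letter instead of its position makes each factor depend only on the two
  arcs at \<open>j\<close>, so inserting into an arc affects only the factors of its
  endpoints.\<close>

definition weight :: "'b::linorder set \<Rightarrow> ('b \<Rightarrow> 'b) \<Rightarrow> 'a" where
  "weight A \<pi> = (\<Prod>j\<in>A. letter (inv \<pi> j < j) (j < \<pi> j))"

text \<open>A new maximum turns the arc \<open>i \<rightarrow> j\<close> into an ascent out of \<open>i\<close> and a descent into \<open>j\<close>, which
  changes the type of \<open>j\<close> if the arc was an ascent and that of \<open>i\<close> otherwise.\<close>

lemma D_letter:
  "D (letter a b) =
     (if a then s * letter False b else 0) + (if b then 0 else s * letter a True)"
  by (simp add: letter_def D_s D_t D_u D_v algebra_simps)

text \<open>The new maximum is a peak, hence the factor \<open>s\<close>. An ascending arc out of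
  \<open>i\<close> changes only the letter \<open>\<sigma> i\<close>, a descending one only the
  letter \<open>i\<close>.\<close>

lemma weight_insert_arc:
  assumes A: "finite A" "\<And>a. a \<in> A \<Longrightarrow> a < m" and \<sigma>: "\<sigma> \<in> derangements_on A" and i: "i \<in> A"
  shows "weight (insert m A) (\<sigma> \<circ> transpose i m) = s *
    (if i < \<sigma> i then letter False (\<sigma> i < \<sigma> (\<sigma> i)) *
        (\<Prod>j\<in>A - {\<sigma> i}. letter (inv \<sigma> j < j) (j < \<sigma> j))
     else letter (inv \<sigma> i < i) True * (\<Prod>j\<in>A - {i}. letter (inv \<sigma> j < j) (j < \<sigma> j)))"
proof -
  let ?\<pi> = "\<sigma> \<circ> transpose i m"
  have perm: "\<sigma> permutes A" and ne: "\<sigma> i \<noteq> i"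
    using \<sigma> i by (auto simp: derangements_on_def)
  have mA: "m \<notin> A" using A(2) by blast
  have \<sigma>m: "\<sigma> m = m" using perm mA by (rule permutes_not_in)
  have \<sigma>i: "\<sigma> i \<in> A" using perm i by (simp add: permutes_in_image)
  have "inv ?\<pi> = transpose i m \<circ> inv \<sigma>"
    using perm by (simp add: o_inv_distrib permutes_bij)
  then have inv_\<pi>: "inv ?\<pi> j = (if j = \<sigma> i then m else if j = m then i else inv \<sigma> j)" for j
    using perm \<sigma>m by (auto simp: transpose_def permutes_inv_eq)
  have \<pi>: "?\<pi> j = (if j = i then m else if j = m then \<sigma> i else \<sigma> j)" for j
    using \<sigma>m by (simp add: transpose_def)
  have max: "letter (inv ?\<pi> m < m) (m < ?\<pi> m) = s"
    using A(2)[OF i] A(2)[OF \<sigma>i] by (auto simp: inv_\<pi> \<pi> letter_def simp del: o_apply)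
  \<comment> \<open>The insertion overrides two comparisons: the arc into \<open>\<sigma> i\<close>
    now descends and the arc out of \<open>i\<close> now ascends.\<close>
  have old: "letter (inv ?\<pi> j < j) (j < ?\<pi> j) =
      letter (j \<noteq> \<sigma> i \<and> inv \<sigma> j < j) (j = i \<or> j < \<sigma> j)" if "j \<in> A" for j
    using that mA A(2)[OF that] ne less_not_sym[OF A(2)[OF \<sigma>i]]
    by (auto simp: inv_\<pi> \<pi> simp del: o_apply)
  have "weight (insert m A) ?\<pi> =
      s * (\<Prod>j\<in>A. letter (j \<noteq> \<sigma> i \<and> inv \<sigma> j < j) (j = i \<or> j < \<sigma> j))"
    using A(1) mA max old by (simp add: weight_def del: o_apply)
  also have "(\<Prod>j\<in>A. letter (j \<noteq> \<sigma> i \<and> inv \<sigma> j < j) (j = i \<or> j < \<sigma> j)) =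
      (if i < \<sigma> i then letter False (\<sigma> i < \<sigma> (\<sigma> i)) *
        (\<Prod>j\<in>A - {\<sigma> i}. letter (inv \<sigma> j < j) (j < \<sigma> j))
       else letter (inv \<sigma> i < i) True * (\<Prod>j\<in>A - {i}. letter (inv \<sigma> j < j) (j < \<sigma> j)))"
  proof (cases "i < \<sigma> i")
    case True
    then have "(\<Prod>j\<in>A - {\<sigma> i}. letter (j \<noteq> \<sigma> i \<and> inv \<sigma> j < j) (j = i \<or> j < \<sigma> j)) =
        (\<Prod>j\<in>A - {\<sigma> i}. letter (inv \<sigma> j < j) (j < \<sigma> j))"
      by (intro prod.cong refl arg_cong2[of _ _ _ _ letter]) auto
    then show ?thesis using True ne by (simp add: prod.remove[OF A(1) \<sigma>i])
  next
    case False
    then have "(\<Prod>j\<in>A - {i}. letter (j \<noteq> \<sigma> i \<and> inv \<sigma> j < j) (j = i \<or> j < \<sigma> j)) =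
        (\<Prod>j\<in>A - {i}. letter (inv \<sigma> j < j) (j < \<sigma> j))"
      using perm by (intro prod.cong refl arg_cong2[of _ _ _ _ letter])
        (auto simp: permutes_inverses)
    then show ?thesis using False ne by (simp add: prod.remove[OF A(1) i])
  qed
  finally show ?thesis .
qed

text \<open>Ascending arcs are charged to their target and descending arcs to their source. Each
  letter then collects the two summands of \<open>D_letter\<close>, and the total is the product
  rule.\<close>

lemma weight_insert_arcs:
  assumes A: "finite A" "\<And>a. a \<in> A \<Longrightarrow> a < m" and \<sigma>: "\<sigma> \<in> derangements_on A"
  shows "(\<Sum>i\<in>A. weight (insert m A) (\<sigma> \<circ> transpose i m)) = D (weight A \<sigma>)"
proof -
  let ?R = "\<lambda>k. \<Prod>j\<in>A - {k}. letter (inv \<sigma> j < j) (j < \<sigma> j)"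
  let ?f = "\<lambda>j. if inv \<sigma> j < j then s * letter False (j < \<sigma> j) * ?R j else 0"
  let ?g = "\<lambda>i. if i < \<sigma> i then 0 else s * letter (inv \<sigma> i < i) True * ?R i"
  have perm: "\<sigma> permutes A" using \<sigma> by (simp add: derangements_on_def)
  have "(\<Sum>i\<in>A. weight (insert m A) (\<sigma> \<circ> transpose i m)) = (\<Sum>i\<in>A. ?f (\<sigma> i) + ?g i)"
    using perm by (intro sum.cong refl)
      (simp add: weight_insert_arc[OF A \<sigma>] permutes_inverses mult.assoc)
  also have "\<dots> = (\<Sum>i\<in>A. ?f (\<sigma> i)) + (\<Sum>i\<in>A. ?g i)"
    by (rule sum.distrib)
  also have "(\<Sum>i\<in>A. ?f (\<sigma> i)) = (\<Sum>j\<in>A. ?f j)"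
    using perm by (intro sum.reindex_bij_betw) (simp add: permutes_imp_bij)
  also have "(\<Sum>j\<in>A. ?f j) + (\<Sum>i\<in>A. ?g i) = D (weight A \<sigma>)"
    unfolding weight_def prod[OF A(1)] sum.distrib[symmetric]
    by (intro sum.cong refl) (simp add: D_letter distrib_right)
  finally show ?thesis .
qed

text \<open>In the new 2-cycle \<open>m\<close> is a peak and \<open>i\<close> a valley; no arc
  between other letters changes.\<close>

lemma weight_insert_2cycle:
  assumes A: "finite A" "\<And>a. a \<in> A \<Longrightarrow> a < m" and i: "i \<in> A"
    and \<sigma>: "\<sigma> \<in> derangements_on (A - {i})"
  shows "weight (insert m A) (\<sigma> \<circ> transpose i m) = s * t * weight (A - {i}) \<sigma>"
proof -
  let ?\<pi> = "\<sigma> \<circ> transpose i m"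
  have perm: "\<sigma> permutes (A - {i})" using \<sigma> by (simp add: derangements_on_def)
  have mA: "m \<notin> A" using A(2) by blast
  have fixed: "\<sigma> m = m" "\<sigma> i = i" using perm mA by (simp_all add: permutes_not_in)
  have "inv ?\<pi> = transpose i m \<circ> inv \<sigma>"
    using perm by (simp add: o_inv_distrib permutes_bij)
  then have inv_\<pi>: "inv ?\<pi> j = (if j = i then m else if j = m then i else inv \<sigma> j)" for j
    using perm fixed by (auto simp: transpose_def permutes_inv_eq)
  have \<pi>: "?\<pi> j = (if j = i then m else if j = m then i else \<sigma> j)" for j
    using fixed by (simp add: transpose_def)
  have new: "letter (inv ?\<pi> m < m) (m < ?\<pi> m) = s" "letter (inv ?\<pi> i < i) (i < ?\<pi> i) = t"
    using A(2)[OF i] by (auto simp: inv_\<pi> \<pi> letter_def simp del: o_apply)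
  have old: "(\<Prod>j\<in>A - {i}. letter (inv ?\<pi> j < j) (j < ?\<pi> j)) = weight (A - {i}) \<sigma>"
    unfolding weight_def using mA by (intro prod.cong refl) (auto simp: inv_\<pi> \<pi> simp del: o_apply)
  have "weight (insert m A) ?\<pi> = s * (\<Prod>j\<in>A. letter (inv ?\<pi> j < j) (j < ?\<pi> j))"
    using A(1) mA new by (simp add: weight_def del: o_apply)
  also have "\<dots> = s * (t * weight (A - {i}) \<sigma>)"
    unfolding prod.remove[OF A(1) i] new old ..
  finally show ?thesis by (simp add: mult.assoc)
qed

section \<open>Recurrence for the derangement polynomials\<close>

fun derangement_poly :: "nat \<Rightarrow> 'a" where
  "derangement_poly 0 = 1"
| "derangement_poly (Suc 0) = 0"
| "derangement_poly (Suc (Suc n)) =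
     D (derangement_poly (Suc n)) + of_nat (Suc n) * (s * t) * derangement_poly n"

text \<open>The maximum is either inserted into an arc of a smaller derangement, which gives the
  \<open>D\<close> term, or paired with one of the remaining elements, whose number is the integer
  factor. Both smaller sizes occur, hence strong induction.\<close>

lemma sum_weight_derangements_on:
  fixes A :: "'b::linorder set"
  assumes "finite A"
  shows "(\<Sum>\<pi>\<in>derangements_on A. weight A \<pi>) = derangement_poly (card A)"
  using assms
proof (induction "card A" arbitrary: A rule: less_induct)
  case less
  show ?case
  proof (cases "A = {}")
    case True
    then have "derangements_on A = {id}" by (auto simp: derangements_on_def)
    then show ?thesis using True by (simp add: weight_def)
  next
    case False
    define m where "m = Max A"
    define B where "B = A - {m}"
    have "m \<in> A" using less.prems False by (simp add: m_def)
    then have B: "finite B" "m \<notin> B" "A = insert m B" "\<And>b. b \<in> B \<Longrightarrow> b < m"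
      using less.prems by (auto simp: B_def m_def less_le)
    have card_A: "card A = Suc (card B)" using B by simp
    have "(\<Sum>\<pi>\<in>derangements_on A. weight A \<pi>) =
        (\<Sum>i\<in>B. \<Sum>\<sigma>\<in>derangements_on B. weight (insert m B) (\<sigma> \<circ> transpose i m)) +
        (\<Sum>i\<in>B. \<Sum>\<sigma>\<in>derangements_on (B - {i}). weight (insert m B) (\<sigma> \<circ> transpose i m))"
      unfolding B(3) sum_derangements_on_insert[OF B(1,2)] sum.distrib ..
    also have "(\<Sum>i\<in>B. \<Sum>\<sigma>\<in>derangements_on B. weight (insert m B) (\<sigma> \<circ> transpose i m)) =
        (\<Sum>\<sigma>\<in>derangements_on B. D (weight B \<sigma>))"
      by (subst sum.swap) (use weight_insert_arcs[OF B(1,4)] in simp)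
    also have "\<dots> = D (derangement_poly (card B))"
      using less.hyps[of B] B(1) card_A by (simp flip: sum)
    also have "(\<Sum>i\<in>B. \<Sum>\<sigma>\<in>derangements_on (B - {i}). weight (insert m B) (\<sigma> \<circ> transpose i m)) =
        (\<Sum>i\<in>B. s * t * derangement_poly (card B - 1))"
    proof (intro sum.cong refl)
      fix i assume i: "i \<in> B"
      have "(\<Sum>\<sigma>\<in>derangements_on (B - {i}). weight (insert m B) (\<sigma> \<circ> transpose i m)) =
          s * t * (\<Sum>\<sigma>\<in>derangements_on (B - {i}). weight (B - {i}) \<sigma>)"
        using weight_insert_2cycle[OF B(1,4) i] by (simp add: sum_distrib_left)
      also have "(\<Sum>\<sigma>\<in>derangements_on (B - {i}). weight (B - {i}) \<sigma>) =
          derangement_poly (card B - 1)"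
        using less.hyps[of "B - {i}"] B(1) i card_A
        by (simp add: card_Diff_singleton card_Diff1_le less_Suc_eq_le)
      finally show "(\<Sum>\<sigma>\<in>derangements_on (B - {i}). weight (insert m B) (\<sigma> \<circ> transpose i m)) =
          s * t * derangement_poly (card B - 1)" .
    qed
    also have "D (derangement_poly (card B)) + (\<Sum>i\<in>B. s * t * derangement_poly (card B - 1)) =
        derangement_poly (card A)"
      \<comment> \<open>For empty \<open>B\<close> the sum is empty and \<open>D 1 = 0\<close>, in
        accordance with the second base case.\<close>
      by (cases "card B") (simp_all add: card_A mult.assoc)
    finally show ?thesis .
  qed
qed

text \<open>Substituting \<open>j = \<pi> i\<close> passes from letters to positions. Neither
  \<open>i\<close> nor \<open>\<pi> i\<close> is fixed, so exactly one of the four types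
  applies.\<close>

lemma weight_eq_stats:
  assumes "\<pi> \<in> derangements n"
  shows "weight {1..n} \<pi> = s ^ cpk n \<pi> * t ^ cval n \<pi> * u ^ cdasc n \<pi> * v ^ cddes n \<pi>"
proof -
  have perm: "\<pi> permutes {1..n}" and ne: "\<And>i. i \<in> {1..n} \<Longrightarrow> \<pi> i \<noteq> i"
    using assms by (auto simp: derangements_def)
  have pow: "x ^ card {i\<in>{1..n}. P i} = (\<Prod>i\<in>{1..n}. if P i then x else 1)" for x :: 'a and P
    by (simp add: prod.If_cases Int_def)
  have "weight {1..n} \<pi> = (\<Prod>i\<in>{1..n}. letter (i < \<pi> i) (\<pi> i < \<pi> (\<pi> i)))"
    unfolding weight_def
    by (subst prod.reindex_bij_betw[OF permutes_imp_bij[OF perm], symmetric])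
      (simp add: permutes_inverses[OF perm])
  also have "\<dots> = (\<Prod>i\<in>{1..n}. (if i < \<pi> i \<and> \<pi> i > \<pi> (\<pi> i) then s else 1) *
      (if i > \<pi> i \<and> \<pi> i < \<pi> (\<pi> i) then t else 1) *
      (if i < \<pi> i \<and> \<pi> i < \<pi> (\<pi> i) then u else 1) *
      (if i > \<pi> i \<and> \<pi> i > \<pi> (\<pi> i) then v else 1))"
  proof (intro prod.cong refl)
    fix i assume i: "i \<in> {1..n}"
    have "\<pi> i \<in> {1..n}" using perm i by (simp only: permutes_in_image)
    then show "letter (i < \<pi> i) (\<pi> i < \<pi> (\<pi> i)) =
      (if i < \<pi> i \<and> \<pi> i > \<pi> (\<pi> i) then s else 1) *
      (if i > \<pi> i \<and> \<pi> i < \<pi> (\<pi> i) then t else 1) *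
      (if i < \<pi> i \<and> \<pi> i < \<pi> (\<pi> i) then u else 1) *
      (if i > \<pi> i \<and> \<pi> i > \<pi> (\<pi> i) then v else 1)"
      using ne[OF i] ne[of "\<pi> i"] by (auto simp: letter_def not_less_iff_gr_or_eq)
  qed
  also have "\<dots> = s ^ cpk n \<pi> * t ^ cval n \<pi> * u ^ cdasc n \<pi> * v ^ cddes n \<pi>"
    unfolding cpk_def cval_def cdasc_def cddes_def pow prod.distrib ..
  finally show ?thesis .
qed

lemma sum_stats_derangements:
  "(\<Sum>\<pi>\<in>derangements n. s ^ cpk n \<pi> * t ^ cval n \<pi> * u ^ cdasc n \<pi> * v ^ cddes n \<pi>) =
     derangement_poly n"
proof -
  have "derangements n = derangements_on {1..n}"
    by (simp add: derangements_def derangements_on_def)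
  then show ?thesis
    using sum_weight_derangements_on[of "{1..n}"] by (simp add: weight_eq_stats del: One_nat_def)
qed

section \<open>Action of the derivation on the Chebyshev polynomials\<close>

lemma D_st: "D (s * t) = s * t * (u + v)"
  by (simp add: mult D_s D_t algebra_simps)

text \<open>Induction along the three-term recurrence: in the derivative, the term from
  \<open>D (s * t) = 2 * h * (s * t)\<close> lowers one coefficient by 1, so that the recurrence can
  be applied backwards to the remaining terms.\<close>

lemma D_cheb_U:
  assumes h: "2 * h = u + v" and Dh: "D h = s * t"
  shows "D (cheb_U (Suc n) (s * t) h) = of_nat (n + 2) * (s * t) * cheb_U n (s * t) h"
proof (induction n rule: induct_nat_012)
  case 0
  show ?case by (simp add: mult Dh)
next
  case 1
  show ?case by (simp add: mult diff Dh D_s D_t h[symmetric])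
next
  case (ge2 n)
  show ?case
    unfolding cheb_U.simps(3)[of "Suc n" "s * t" h]
    by (simp only: diff mult numeral Dh D_s D_t ge2 h[symmetric])
      (simp add: algebra_simps)
qed

end

section \<open>The generating functions\<close>

lemma of_nat_Suc_mult_qconst_inverse_fact:
  "of_nat (Suc n) * qconst (1 / fact (Suc n)) = qconst (1 / fact n)"
  by (simp add: qconst_def mult_single flip: single_of_nat)

text \<open>Positive integers are units of the coefficient ring, so a power series is determined by
  its derivative and constant term.\<close>

lemma of_nat_Suc_mult_eq_0_iff: "of_nat (Suc n) * (x :: qpoly4) = 0 \<longleftrightarrow> x = 0"
proof
  assume "of_nat (Suc n) * x = 0"
  then have "qconst (1 / of_nat (Suc n)) * of_nat (Suc n) * x = 0"
    by (simp add: mult.assoc)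
  moreover have "qconst (1 / of_nat (Suc n)) * of_nat (Suc n) = 1"
    by (simp add: qconst_def mult_single flip: single_of_nat)
  ultimately show "x = 0" by simp
qed simp

theorem theorem8:
  "derangement_gf (qvar Var_s) (qvar Var_t) (qvar Var_u) (qvar Var_v) =
     fps_recip (1 - fps_const (qvar Var_s * qvar Var_t) *
       cheb_V (qvar Var_s * qvar Var_t) ((qvar Var_u + qvar Var_v) * qconst (1 / 2)))"
proof -
  define s t u v where "s = qvar Var_s" and "t = qvar Var_t" and "u = qvar Var_u" and "v = qvar Var_v"
  note vars = s_def t_def u_def v_def
  define h where "h = (u + v) * qconst (1 / 2)"
  \<comment> \<open>A combination of partial derivatives whose coefficients are the prescribed
    values on the variables.\<close>
  define D where "D = (\<lambda>f. s * (u + v) * pm_deriv Var_s f +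
     (s * t * pm_deriv Var_u f + s * t * pm_deriv Var_v f))"
  have "derivation D"
    unfolding D_def by (intro derivation_plus derivation_scale derivation_pm_deriv)
  then interpret derivation D .
  interpret cyclic_grammar D s t u v
    by unfold_locales (simp_all add: D_def vars pm_deriv_qvar)
  interpret fps: derivation "fps_map D" by (rule derivation_fps_map)
  have D_qconst: "D (qconst c) = 0" for c by (simp add: D_def pm_deriv_qconst)
  have D_mult_qconst: "D (x * qconst c) = D x * qconst c" for x c
    by (simp add: mult D_qconst)
  have X_nth: "fps_nth (fps_const c * fps_X * F) n = (if n = 0 then 0 else c * fps_nth F (n - 1))"
    for c :: qpoly4 and F n
    by (simp add: mult.assoc)
  have half: "2 * qconst (1 / 2) = 1"
    by (simp add: qconst_def mult_single flip: single_numeral)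
  have h: "2 * h = u + v" by (simp add: h_def half mult.left_commute)
  have Dh: "D h = s * t"
    using half by (simp add: h_def mult add D_u D_v D_qconst algebra_simps)
  let ?c = "\<lambda>n. qconst (1 / fact n)"
  have c_Suc: "of_nat (Suc n) * (x * ?c (Suc n)) = x * ?c n" for n x
    using of_nat_Suc_mult_qconst_inverse_fact[of n] by (simp only: mult.left_commute)
  have c0: "qconst 1 = 1" "?c 0 = 1" "?c (Suc 0) = 1" by (simp_all add: qconst_def)

  define G where "G = derangement_gf s t u v"
  define W where "W = fps_const (s * t) * cheb_V (s * t) h"
  have G_nth: "fps_nth G n = derangement_poly n * ?c n" for n
    by (simp add: G_def derangement_gf_def sum_stats_derangements c0)
  have W_nth: "fps_nth W n = (if n < 2 then 0 else s * t * cheb_U (n - 2) (s * t) h * ?c n)" for n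
    by (simp add: W_def cheb_V_def mult.assoc)

  have G': "fps_deriv G = fps_map D G + fps_const (s * t) * fps_X * G"
  proof (rule fps_ext)
    fix n
    show "fps_nth (fps_deriv G) n = fps_nth (fps_map D G + fps_const (s * t) * fps_X * G) n"
    proof (cases n)
      case 0
      then show ?thesis by (simp add: G_nth c0 mult.assoc)
    next
      case (Suc k)
      have "fps_nth (fps_deriv G) n = derangement_poly (Suc (Suc k)) * ?c (Suc k)"
        using c_Suc[of "Suc k"] by (simp add: Suc G_nth del: derangement_poly.simps of_nat_Suc fact_Suc)
      also have "\<dots> = D (derangement_poly (Suc k)) * ?c (Suc k) +
          s * t * (of_nat (Suc k) * (derangement_poly k * ?c (Suc k)))"
        by (simp only: derangement_poly.simps) (simp only: ring_distribs mult_ac)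
      also have "\<dots> = fps_nth (fps_map D G + fps_const (s * t) * fps_X * G) n"
        unfolding c_Suc by (simp add: Suc G_nth D_mult_qconst X_nth del: fact_Suc)
      finally show ?thesis .
    qed
  qed

  \<comment> \<open>With \<open>F = 1 - W\<close> this is the equation
    \<open>F' = D F - s t x F\<close> with its sign reversed.\<close>
  have W': "fps_deriv W = fps_map D W + fps_const (s * t) * fps_X * (1 - W)"
  proof (rule fps_ext)
    fix n
    \<comment> \<open>The coefficients of \<open>W\<close> start at 2 and the constant 1 of
      \<open>1 - W\<close> enters only at \<open>n = 1\<close>; the Chebyshev recurrence applies
      from \<open>n = 3\<close> on.\<close>
    consider "n = 0" | "n = 1" | "n = 2" | k where "n = Suc (Suc (Suc k))"
      by (metis One_nat_def Suc_1 nat.exhaust)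
    then show "fps_nth (fps_deriv W) n =
        fps_nth (fps_map D W + fps_const (s * t) * fps_X * (1 - W)) n"
    proof cases
      case 1
      then show ?thesis by (simp add: W_nth mult.assoc)
    next
      case 2
      then show ?thesis using c_Suc[of 1 "s * t"] c0 by (simp add: W_nth mult.assoc)
    next
      case 3
      then show ?thesis using c_Suc[of 2 "s * t * cheb_U 1 (s * t) h"]
        by (simp add: W_nth mult D_s D_t D_qconst h[symmetric] mult_ac numeral_2_eq_2 numeral_3_eq_3)
    next
      case 4
      let ?n = "Suc (Suc (Suc k))"
      let ?U = "\<lambda>j. cheb_U j (s * t) h"
      have "fps_nth (fps_deriv W) n = s * t * ?U (Suc (Suc k)) * ?c ?n"
        using c_Suc[of ?n "s * t * ?U (Suc (Suc k))"]
        by (simp add: 4 W_nth del: cheb_U.simps of_nat_Suc fact_Suc)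
      \<comment> \<open>\<open>D_cheb_U\<close> contributes the factor \<open>k + 2\<close>, against
        \<open>k + 3\<close> in the subtracted term; the difference is the last term of the
        recurrence.\<close>
      also have "\<dots> = D (s * t * ?U (Suc k)) * ?c ?n - s * t * (of_nat ?n * (s * t * ?U k * ?c ?n))"
        by (simp only: cheb_U.simps mult[of "s * t"] D_cheb_U[OF h Dh] D_st h[symmetric])
          (simp add: algebra_simps del: fact_Suc)
      also have "\<dots> = fps_nth (fps_map D W + fps_const (s * t) * fps_X * (1 - W)) n"
        unfolding c_Suc
        by (simp add: 4 W_nth D_mult_qconst X_nth
            del: fact_Suc cheb_U.simps)
      finally show ?thesis .
    qed
  qed

  define P where "P = G * (1 - W)"
  \<comment> \<open>The two terms with \<open>fps_X\<close> cancel in the product rule.\<close>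
  have P': "fps_deriv P = fps_map D P"
    by (simp add: P_def G' W' fps.mult fps.diff algebra_simps)
  \<comment> \<open>Each coefficient found so far is 0 or 1 and is killed by \<open>D\<close>, which
    forces the next one to vanish.\<close>
  have "fps_nth P n = (if n = 0 then 1 else 0)" for n
  proof (induction n)
    case 0
    show ?case by (simp add: P_def G_nth W_nth c0)
  next
    case (Suc n)
    have "of_nat (Suc n) * fps_nth P (Suc n) = D (fps_nth P n)"
      using arg_cong[OF P', of "\<lambda>F. fps_nth F n"] by simp
    also have "\<dots> = 0" by (simp add: Suc)
    finally show ?case by (simp only: of_nat_Suc_mult_eq_0_iff) simp
  qed
  then have "P = 1" by (simp add: fps_eq_iff)
  then have "G = fps_recip (1 - W)"
    using fps_recip_unique[of "1 - W" G] by (simp add: P_def W_nth)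
  then show ?thesis by (simp add: G_def W_def h_def vars)
qed

end
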